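(* Let $\omega$ be an environment with $v(0,0)>0$. For every $t\in\mathbb{N}$ and $y\in\mathbb{Z}$, $$p(t,y;\omega)=\mathbb{P}^{\omega}_{(0,0)}(X_t=(t,y)).$$
   Context: Environment. Let $\{v(0,k):k\in\mathbb{Z}\}$ be i.i.d. Poisson(1) random variables. For each $k\in\mathbb{Z}$ and $1\le i\le v(0,k)$ let $S^{(k,i)}=(S^{(k,i)}(t))_{t\in\mathbb{Z}}$ be a two-sided symmetric nearest-neighbour simple random walk on $\mathbb{Z}$ with $S^{(k,i)}(0)=k$, all these walks being independent. For $(t,y)\in\mathbb{Z}^2$ put $e^{+}(t,y)=\#\{(k,i):S^{(k,i)}(t)=y,\ S^{(k,i)}(t+1)=y+1\}$, $e^{-}(t,y)=\#\{(k,i):S^{(k,i)}(t)=y,\ S^{(k,i)}(t+1)=y-1\}$, and $v(t,y)=\#\{(k,i):S^{(k,i)}(t)=y\}=e^+(t,y)+e^-(t,y)$; consequently $v(t,y)=e^+(t-1,y-1)+e^-(t-1,y+1)$. The environment is $\omega=\{(e^+(t,y),e^-(t,y)):(t,y)\in\mathbb{Z}^2\}$; only environments arising this way (in particular satisfying the two displayed identities for $v$, with all values finite) are considered. Random mass splitting. For $\omega$ with $v(0,0)>0$, the mass distribution is defined by $p(0,0;\omega)=1$, $p(0,y;\omega)=0$ for $y\ne0$, and for integers $t\ge0$ and $y\in\mathbb{Z}$, $$p(t+1,y;\omega)=p(t,y+1;\omega)\frac{e^-(t,y+1)}{v(t,y+1)}+p(t,y-1;\omega)\frac{e^+(t,y-1)}{v(t,y-1)},$$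 where a term whose denominator (and hence numerator) vanishes is taken to be $0$. Random walk in the environment. For fixed $\omega$ with $v(0,0)>0$, under the quenched law $\mathbb{P}^{\omega}_{(0,0)}$ the sequence $(X_n)_{n\ge0}$ is the Markov chain on $\mathbb{Z}^2$ (first coordinate is time, second is space) with $X_0=(0,0)$ and $\mathbb{P}^{\omega}_{(0,0)}(X_{n+1}=(t'+1,y'\pm1)\mid X_n=(t',y'))=e^{\pm}(t',y')/v(t',y')$. *)

theory Defs
  imports "HOL-Probability.Probability"
begin

text \<open>
  A two-sided simple random walk started at time \<open>0\<close> from \<open>k\<close>. Every sample path, not merely almost
  every one, is a nearest-neighbour path.
\<close>

definition two_sided_srw :: "'a measure \<Rightarrow> int \<Rightarrow> (int \<Rightarrow> 'a \<Rightarrow> int) \<Rightarrow> bool" where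
  "two_sided_srw M k W \<longleftrightarrow>
     (\<forall>\<xi>\<in>space M. W 0 \<xi> = k \<and> (\<forall>t. W (t + 1) \<xi> - W t \<xi> \<in> {1, -1})) \<and>
     prob_space.indep_vars M (\<lambda>_. count_space UNIV) (\<lambda>t \<xi>. W (t + 1) \<xi> - W t \<xi>) UNIV \<and>
     (\<forall>t. \<P>(\<xi> in M. W (t + 1) \<xi> - W t \<xi> = 1) = 1 / 2 \<and>
          \<P>(\<xi> in M. W (t + 1) \<xi> - W t \<xi> = -1) = 1 / 2)"

text \<open>
  \<open>N k\<close> is the initial number of walkers at \<open>k\<close>, and \<open>S k i\<close> with \<open>i \<ge> 1\<close> is the walk of the \<open>i\<close>-th
  of them. Walks are provided for all \<open>i \<ge> 1\<close>; only those with \<open>i \<le> N k\<close> enter the environment.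
  The last conjunct is the mutual independence of all the initial counts and all the walks, each
  walk being regarded as a random element of the path space.
\<close>

definition poisson_walk_system ::
    "'a measure \<Rightarrow> (int \<Rightarrow> 'a \<Rightarrow> nat) \<Rightarrow> (int \<Rightarrow> nat \<Rightarrow> int \<Rightarrow> 'a \<Rightarrow> int) \<Rightarrow> bool" where
  "poisson_walk_system M N S \<longleftrightarrow>
     prob_space M \<and>
     (\<forall>k. distr M (count_space UNIV) (N k) = measure_pmf (poisson_pmf 1)) \<and>
     (\<forall>k. \<forall>i\<ge>1. two_sided_srw M k (S k i)) \<and>
     prob_space.indep_sets M
       (\<lambda>j. case j of
          Inl k \<Rightarrow> sets (vimage_algebra (space M) (N k) (count_space UNIV))
        | Inr (k, i) \<Rightarrow>
            sets (vimage_algebra (space M) (\<lambda>\<xi> t. S k i t \<xi>) (PiM UNIV (\<lambda>_. count_space UNIV))))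
       (UNIV <+> UNIV \<times> {1..})"

text \<open>An environment maps \<open>t\<close> and \<open>y\<close> to the pair of \<open>e\<^sup>+(t,y)\<close> and \<open>e\<^sup>-(t,y)\<close>.\<close>

type_synonym env = "int \<Rightarrow> int \<Rightarrow> nat \<times> nat"

definition eplus :: "env \<Rightarrow> int \<Rightarrow> int \<Rightarrow> nat" where
  "eplus \<omega> t y = fst (\<omega> t y)"

definition eminus :: "env \<Rightarrow> int \<Rightarrow> int \<Rightarrow> nat" where
  "eminus \<omega> t y = snd (\<omega> t y)"

definition occ :: "env \<Rightarrow> int \<Rightarrow> int \<Rightarrow> nat" where
  "occ \<omega> t y = eplus \<omega> t y + eminus \<omega> t y"

definition walkers ::
    "(int \<Rightarrow> 'a \<Rightarrow> nat) \<Rightarrow> (int \<Rightarrow> nat \<Rightarrow> int \<Rightarrow> 'a \<Rightarrow> int) \<Rightarrow> 'a \<Rightarrow> int \<Rightarrow> int \<Rightarrow> (int \<times> nat) set" where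
  "walkers N S \<xi> t y = {(k, i). 1 \<le> i \<and> i \<le> N k \<xi> \<and> S k i t \<xi> = y}"

definition environment ::
    "(int \<Rightarrow> 'a \<Rightarrow> nat) \<Rightarrow> (int \<Rightarrow> nat \<Rightarrow> int \<Rightarrow> 'a \<Rightarrow> int) \<Rightarrow> 'a \<Rightarrow> env" where
  "environment N S \<xi> t y =
     (card (walkers N S \<xi> t y \<inter> walkers N S \<xi> (t + 1) (y + 1)),
      card (walkers N S \<xi> t y \<inter> walkers N S \<xi> (t + 1) (y - 1)))"

text \<open>
  The cardinalities above are those of finite sets, \<open>occ\<close> counts the walkers at a site, and walkers
  are conserved from one time to the next.
\<close>

lemma srw_range:
  fixes W :: "int \<Rightarrow> 'a \<Rightarrow> int"
  assumes "two_sided_srw M k W" "\<xi> \<in> space M"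
  shows "\<bar>W t \<xi> - k\<bar> \<le> \<bar>t\<bar>"
proof -
  have step: "W (t + 1) \<xi> = W t \<xi> + 1 \<or> W (t + 1) \<xi> = W t \<xi> - 1" for t
  proof -
    have "W (t + 1) \<xi> - W t \<xi> \<in> {1, -1}"
      using assms unfolding two_sided_srw_def by blast
    then show ?thesis by auto
  qed
  have zero: "W 0 \<xi> = k"
    using assms unfolding two_sided_srw_def by blast
  show ?thesis
  proof (induction t rule: int_induct[where k = 0])
    case base
    then show ?case using zero by simp
  next
    case (step1 i)
    then show ?case using step[of i] by auto
  next
    case (step2 i)
    then show ?case using step[of "i - 1"] by auto
  qed
qed

lemma finite_walkers:
  assumes "poisson_walk_system M N S" "\<xi> \<in> space M"
  shows "finite (walkers N S \<xi> t y)"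
proof (rule finite_subset)
  have range: "\<bar>S k i t \<xi> - k\<bar> \<le> \<bar>t\<bar>" if "1 \<le> i" for k i
    using srw_range[of M k "S k i" \<xi> t] assms that by (simp add: poisson_walk_system_def)
  show "walkers N S \<xi> t y \<subseteq> (SIGMA k:{y - \<bar>t\<bar>..y + \<bar>t\<bar>}. {1..N k \<xi>})"
  proof
    fix a
    assume "a \<in> walkers N S \<xi> t y"
    then show "a \<in> (SIGMA k:{y - \<bar>t\<bar>..y + \<bar>t\<bar>}. {1..N k \<xi>})"
      using range[of "snd a" "fst a"] by (cases a) (simp add: walkers_def abs_le_iff)
  qed
qed simp

lemma walker_step:
  assumes "poisson_walk_system M N S" "\<xi> \<in> space M" "1 \<le> i"
  shows "S k i (t + 1) \<xi> = S k i t \<xi> + 1 \<or> S k i (t + 1) \<xi> = S k i t \<xi> - 1"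
proof -
  have "two_sided_srw M k (S k i)"
    using assms by (simp add: poisson_walk_system_def)
  then have "S k i (t + 1) \<xi> - S k i t \<xi> \<in> {1, -1}"
    using assms(2) unfolding two_sided_srw_def by blast
  then show ?thesis by auto
qed

lemma card_walkers_split:
  assumes "finite A" "A = B \<union> C" "B \<inter> C = {}"
  shows "card A = card B + card C"
  using assms by (simp add: card_Un_disjoint)

lemma occ_environment:
  assumes "poisson_walk_system M N S" "\<xi> \<in> space M"
  shows "occ (environment N S \<xi>) t y = card (walkers N S \<xi> t y)"
proof -
  let ?A = "\<lambda>z. walkers N S \<xi> t y \<inter> walkers N S \<xi> (t + 1) z"
  have "a \<in> ?A (y + 1) \<union> ?A (y - 1)" if "a \<in> walkers N S \<xi> t y" for a
    using walker_step[OF assms, of "snd a" "fst a" t] that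
    by (cases a) (simp add: walkers_def)
  then have "walkers N S \<xi> t y = ?A (y + 1) \<union> ?A (y - 1)"
    by blast
  moreover have "?A (y + 1) \<inter> ?A (y - 1) = {}"
    by (simp add: walkers_def set_eq_iff)
  ultimately have "card (walkers N S \<xi> t y) = card (?A (y + 1)) + card (?A (y - 1))"
    by (rule card_walkers_split[OF finite_walkers[OF assms]])
  then show ?thesis
    by (simp add: occ_def eplus_def eminus_def environment_def)
qed

lemma occ_inflow:
  assumes "poisson_walk_system M N S" "\<xi> \<in> space M"
  shows "occ (environment N S \<xi>) t y =
    eplus (environment N S \<xi>) (t - 1) (y - 1) + eminus (environment N S \<xi>) (t - 1) (y + 1)"
proof -
  let ?A = "\<lambda>z. walkers N S \<xi> (t - 1) z \<inter> walkers N S \<xi> t y"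
  have "a \<in> ?A (y - 1) \<union> ?A (y + 1)" if "a \<in> walkers N S \<xi> t y" for a
    using walker_step[OF assms, of "snd a" "fst a" "t - 1"] that
    by (cases a) (auto simp add: walkers_def)
  then have "walkers N S \<xi> t y = ?A (y - 1) \<union> ?A (y + 1)"
    by blast
  moreover have "?A (y - 1) \<inter> ?A (y + 1) = {}"
    by (simp add: walkers_def set_eq_iff)
  ultimately have "card (walkers N S \<xi> t y) = card (?A (y - 1)) + card (?A (y + 1))"
    by (rule card_walkers_split[OF finite_walkers[OF assms]])
  then show ?thesis
    unfolding occ_environment[OF assms] by (simp add: eplus_def eminus_def environment_def)
qed

text \<open>A term with vanishing denominator is \<open>0\<close>, by the convention \<open>x / 0 = 0\<close>.\<close>

primrec mass :: "env \<Rightarrow> nat \<Rightarrow> int \<Rightarrow> real" where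
  "mass \<omega> 0 y = (if y = 0 then 1 else 0)"
| "mass \<omega> (Suc t) y =
     mass \<omega> t (y + 1) * (real (eminus \<omega> (int t) (y + 1)) / real (occ \<omega> (int t) (y + 1))) +
     mass \<omega> t (y - 1) * (real (eplus \<omega> (int t) (y - 1)) / real (occ \<omega> (int t) (y - 1)))"

definition markov_chain :: "'b measure \<Rightarrow> (nat \<Rightarrow> 'b \<Rightarrow> 's::countable) \<Rightarrow> bool" where
  "markov_chain P X \<longleftrightarrow>
     prob_space P \<and>
     (\<forall>n. X n \<in> measurable P (count_space UNIV)) \<and>
     (\<forall>n x z. \<P>(w in P. \<forall>m\<le>n. X m w = x m) > 0 \<longrightarrow>
        \<P>(w in P. X (Suc n) w = z \<bar> \<forall>m\<le>n. X m w = x m) = \<P>(w in P. X (Suc n) w = z \<bar> X n w = x n))"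

text \<open>
  \<open>X\<close> under \<open>P\<close> has the quenched law started from the origin. The one-step probabilities are
  prescribed at the states that are reached with positive probability and at which
  \<open>e\<^sup>\<plusminus> / v\<close> has a nonzero denominator.
\<close>

definition quenched_walk :: "env \<Rightarrow> 'b measure \<Rightarrow> (nat \<Rightarrow> 'b \<Rightarrow> int \<times> int) \<Rightarrow> bool" where
  "quenched_walk \<omega> P X \<longleftrightarrow>
     markov_chain P X \<and>
     \<P>(w in P. X 0 w = (0, 0)) = 1 \<and>
     (\<forall>n t y. \<P>(w in P. X n w = (t, y)) > 0 \<and> occ \<omega> t y > 0 \<longrightarrow>
        \<P>(w in P. X (Suc n) w = (t + 1, y + 1) \<bar> X n w = (t, y)) = real (eplus \<omega> t y) / real (occ \<omega> t y) \<and>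
        \<P>(w in P. X (Suc n) w = (t + 1, y - 1) \<bar> X n w = (t, y)) = real (eminus \<omega> t y) / real (occ \<omega> t y))"

end

theory Submission
  imports Defs
begin

text \<open>
  Both sides obey the same recursion in time: splitting the event that the walk is at \<open>(t + 1, y)\<close>
  according to the position at time \<open>t\<close>, the Markov transition probabilities are exactly the
  proportions in which the mass is split.

  Two points need an argument, because the transition probabilities are prescribed only at sites
  that are reached with positive probability and have positive occupation number. The walk must
  never get stuck on an empty site, and it must not reach \<open>(t + 1, y)\<close> from anywhere but the two
  neighbours. Both follow from one fact: at an occupied site the two prescribed probabilities add up
  to \<open>1\<close>, so almost surely the walk follows an edge crossed by at least one walker of the
  environment (\<open>AE_quenched_walk_step\<close>). Walkers are conserved, so the far end of such an edge is
  again occupied, and by induction the walk stays on occupied sites of the space-time lattice at the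
  correct time (\<open>AE_quenched_walk_on_occupied\<close>).
\<close>

definition occupied_edge :: "env \<Rightarrow> int \<times> int \<Rightarrow> int \<times> int \<Rightarrow> bool" where
  "occupied_edge \<omega> x z \<longleftrightarrow>
     (z = (fst x + 1, snd x + 1) \<and> eplus \<omega> (fst x) (snd x) > 0) \<or>
     (z = (fst x + 1, snd x - 1) \<and> eminus \<omega> (fst x) (snd x) > 0)"

lemma quenched_walk_prob_space: "quenched_walk \<omega> P X \<Longrightarrow> prob_space P"
  by (simp add: quenched_walk_def markov_chain_def)

lemma quenched_walk_measurable:
  "quenched_walk \<omega> P X \<Longrightarrow> X n \<in> measurable P (count_space UNIV)"
  by (simp add: quenched_walk_def markov_chain_def)

lemma quenched_walk_sets:
  assumes "quenched_walk \<omega> P X"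
  shows "{w \<in> space P. Q (X n w)} \<in> sets P"
    and "{w \<in> space P. R (X n w) (X (Suc n) w)} \<in> sets P"
proof -
  note [measurable] = quenched_walk_measurable[OF assms]
  show "{w \<in> space P. Q (X n w)} \<in> sets P"
    by measurable
  show "{w \<in> space P. R (X n w) (X (Suc n) w)} \<in> sets P"
    by measurable
qed

text \<open>
  Written with joint instead of conditional probabilities, the transition law holds also at sites
  that are reached with probability \<open>0\<close>.
\<close>

lemma quenched_walk_joint_prob:
  assumes "quenched_walk \<omega> P X" and "occ \<omega> t y > 0"
  shows "\<P>(w in P. X n w = (t, y) \<and> X (Suc n) w = (t + 1, y + 1)) =
           \<P>(w in P. X n w = (t, y)) * (real (eplus \<omega> t y) / real (occ \<omega> t y))"
    and "\<P>(w in P. X n w = (t, y) \<and> X (Suc n) w = (t + 1, y - 1)) =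
           \<P>(w in P. X n w = (t, y)) * (real (eminus \<omega> t y) / real (occ \<omega> t y))"
proof -
  interpret prob_space P
    using assms(1) by (rule quenched_walk_prob_space)
  have joint: "\<P>(w in P. X n w = (t, y) \<and> X (Suc n) w = z) = \<P>(w in P. X n w = (t, y)) * c"
    if "\<P>(w in P. X n w = (t, y)) > 0 \<Longrightarrow> \<P>(w in P. X (Suc n) w = z \<bar> X n w = (t, y)) = c" for z c
  proof (cases "\<P>(w in P. X n w = (t, y)) = 0")
    case True
    have "\<P>(w in P. X n w = (t, y) \<and> X (Suc n) w = z) \<le> \<P>(w in P. X n w = (t, y))"
      by (intro finite_measure_mono quenched_walk_sets(1)[OF assms(1)]) auto
    with True show ?thesis
      by (simp add: measure_le_0_iff)
  next
    case False
    then have "\<P>(w in P. X n w = (t, y)) > 0"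
      by (simp add: zero_less_measure_iff)
    from that[OF this] False show ?thesis
      by (simp add: cond_prob_def field_simps conj_commute)
  qed
  show "\<P>(w in P. X n w = (t, y) \<and> X (Suc n) w = (t + 1, y + 1)) =
          \<P>(w in P. X n w = (t, y)) * (real (eplus \<omega> t y) / real (occ \<omega> t y))"
    and "\<P>(w in P. X n w = (t, y) \<and> X (Suc n) w = (t + 1, y - 1)) =
          \<P>(w in P. X n w = (t, y)) * (real (eminus \<omega> t y) / real (occ \<omega> t y))"
    by (rule joint, use assms in \<open>simp add: quenched_walk_def\<close>)+
qed

text \<open>
  For each of the countably many sites, the joint probabilities of the two prescribed steps add up
  to the probability of the site, which leaves no probability for any other step.
\<close>

lemma AE_quenched_walk_step:
  assumes "quenched_walk \<omega> P X"
  shows "AE w in P. occ \<omega> (fst (X n w)) (snd (X n w)) > 0 \<longrightarrow> occupied_edge \<omega> (X n w) (X (Suc n) w)"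
proof -
  interpret prob_space P
    using assms by (rule quenched_walk_prob_space)
  note S = quenched_walk_sets[OF assms, where n = n]
  have "AE w in P. X n w = (t, y) \<longrightarrow> occupied_edge \<omega> (t, y) (X (Suc n) w)"
    if occ: "occ \<omega> t y > 0" for t y
  proof -
    let ?A = "{w \<in> space P. X n w = (t, y)}"
    let ?U = "{w \<in> space P. X n w = (t, y) \<and> X (Suc n) w = (t + 1, y + 1)}"
    let ?D = "{w \<in> space P. X n w = (t, y) \<and> X (Suc n) w = (t + 1, y - 1)}"
    note joint = quenched_walk_joint_prob[OF assms occ, of n]
    have sets: "?A \<in> sets P" "?U \<in> sets P" "?D \<in> sets P"
      by (rule S(1), (rule S(2))+)
    have "prob (?U \<union> ?D) = prob ?U + prob ?D"
      using sets by (intro finite_measure_Union) auto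
    also have "\<dots> = prob ?A * ((real (eplus \<omega> t y) + real (eminus \<omega> t y)) / real (occ \<omega> t y))"
      by (simp only: joint add_divide_distrib distrib_left)
    also have "\<dots> = prob ?A"
      using occ by (simp flip: of_nat_add occ_def)
    finally have "prob (?A - (?U \<union> ?D)) = 0"
      using sets by (subst finite_measure_Diff) auto
    then have "AE w in P. w \<notin> ?A - (?U \<union> ?D)"
      using sets by (intro AE_not_in) (auto simp: null_sets_def emeasure_eq_measure)
    moreover have "AE w in P. w \<notin> ?U" if "eplus \<omega> t y = 0"
      using sets joint(1) that
      by (intro AE_not_in) (auto simp: null_sets_def emeasure_eq_measure)
    moreover have "AE w in P. w \<notin> ?D" if "eminus \<omega> t y = 0"
      using sets joint(2) that
      by (intro AE_not_in) (auto simp: null_sets_def emeasure_eq_measure)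
    ultimately have "AE w in P. w \<notin> ?A - (?U \<union> ?D) \<and>
        (eplus \<omega> t y = 0 \<longrightarrow> w \<notin> ?U) \<and> (eminus \<omega> t y = 0 \<longrightarrow> w \<notin> ?D)"
      by (cases "eplus \<omega> t y = 0"; cases "eminus \<omega> t y = 0") auto
    with AE_space show ?thesis
      by eventually_elim (auto simp: occupied_edge_def)
  qed
  then have "AE w in P. \<forall>x. occ \<omega> (fst x) (snd x) > 0 \<longrightarrow>
      X n w = x \<longrightarrow> occupied_edge \<omega> x (X (Suc n) w)"
    unfolding AE_all_countable by (auto simp: split_paired_all)
  then show ?thesis
    by eventually_elim blast
qed

lemma occupied_edge_imp_occ_pos:
  assumes inflow: "\<And>t y. occ \<omega> t y = eplus \<omega> (t - 1) (y - 1) + eminus \<omega> (t - 1) (y + 1)"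
    and "occupied_edge \<omega> x z"
  shows "occ \<omega> (fst z) (snd z) > 0"
  using assms(2) inflow[of "fst z" "snd z"] by (auto simp: occupied_edge_def)

lemma AE_quenched_walk_on_occupied:
  assumes inflow: "\<And>t y. occ \<omega> t y = eplus \<omega> (t - 1) (y - 1) + eminus \<omega> (t - 1) (y + 1)"
    and start: "occ \<omega> 0 0 > 0"
    and walk: "quenched_walk \<omega> P X"
  shows "AE w in P. fst (X n w) = int n \<and> occ \<omega> (int n) (snd (X n w)) > 0"
proof (induction n)
  case 0
  interpret prob_space P
    using walk by (rule quenched_walk_prob_space)
  have "AE w in P. X 0 w = (0, 0)"
    using walk quenched_walk_sets(1)[OF walk] by (simp add: prob_Collect_eq_1 quenched_walk_def)
  then show ?case
    by eventually_elim (use start in simp)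
next
  case (Suc n)
  with AE_quenched_walk_step[OF walk, of n] show ?case
  proof eventually_elim
    case (elim w)
    then have edge: "occupied_edge \<omega> (X n w) (X (Suc n) w)" and "fst (X n w) = int n"
      by auto
    then have "fst (X (Suc n) w) = int (Suc n)"
      by (auto simp: occupied_edge_def)
    with occupied_edge_imp_occ_pos[OF inflow edge] show ?case
      by simp
  qed
qed

text \<open>
  Almost surely, reaching \<open>(n + 1, y)\<close> means coming from one of the two neighbours of \<open>y\<close>. An empty
  neighbour contributes \<open>0\<close> to either side: to the left because the walk does not visit it, and to
  the right because of the convention \<open>x / 0 = 0\<close>.
\<close>

lemma quenched_walk_prob_Suc:
  assumes inflow: "\<And>t y. occ \<omega> t y = eplus \<omega> (t - 1) (y - 1) + eminus \<omega> (t - 1) (y + 1)"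
    and start: "occ \<omega> 0 0 > 0"
    and walk: "quenched_walk \<omega> P X"
  shows "\<P>(w in P. X (Suc n) w = (int (Suc n), y)) =
    \<P>(w in P. X n w = (int n, y + 1)) *
      (real (eminus \<omega> (int n) (y + 1)) / real (occ \<omega> (int n) (y + 1))) +
    \<P>(w in P. X n w = (int n, y - 1)) *
      (real (eplus \<omega> (int n) (y - 1)) / real (occ \<omega> (int n) (y - 1)))"
proof -
  interpret prob_space P
    using walk by (rule quenched_walk_prob_space)
  note S = quenched_walk_sets[OF walk, where n = n]
  note occupied = AE_quenched_walk_on_occupied[OF inflow start walk, of n]
  let ?z = "(int n + 1, y)"
  let ?D = "{w \<in> space P. X n w = (int n, y + 1) \<and> X (Suc n) w = ?z}"
  let ?U = "{w \<in> space P. X n w = (int n, y - 1) \<and> X (Suc n) w = ?z}"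
  have sets: "?D \<in> sets P" "?U \<in> sets P"
    by (rule S(2))+
  \<comment> \<open>At an empty site both sides of the joint law are \<open>0\<close>: the walk does not visit it.\<close>
  have unvisited: "\<P>(w in P. X n w = (int n, x) \<and> Q w) = 0" if "occ \<omega> (int n) x = 0" for x Q
  proof -
    have "AE w in P. \<not> (X n w = (int n, x) \<and> Q w)"
      using occupied by eventually_elim (use that in auto)
    then show ?thesis
      by (rule prob_eq_0_AE)
  qed
  have D: "prob ?D = \<P>(w in P. X n w = (int n, y + 1)) *
      (real (eminus \<omega> (int n) (y + 1)) / real (occ \<omega> (int n) (y + 1)))"
    using quenched_walk_joint_prob(2)[OF walk, of "int n" "y + 1" n] unvisited[of "y + 1"]
    by (cases "occ \<omega> (int n) (y + 1) = 0") auto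
  have U: "prob ?U = \<P>(w in P. X n w = (int n, y - 1)) *
      (real (eplus \<omega> (int n) (y - 1)) / real (occ \<omega> (int n) (y - 1)))"
    using quenched_walk_joint_prob(1)[OF walk, of "int n" "y - 1" n] unvisited[of "y - 1"]
    by (cases "occ \<omega> (int n) (y - 1) = 0") auto
  have "\<P>(w in P. X (Suc n) w = ?z) = prob (?D \<union> ?U)"
  proof (rule finite_measure_eq_AE)
    show "AE w in P. w \<in> {w \<in> space P. X (Suc n) w = ?z} \<longleftrightarrow> w \<in> ?D \<union> ?U"
      using AE_quenched_walk_step[OF walk, of n] occupied
      by eventually_elim (auto simp: occupied_edge_def prod_eq_iff)
  qed (use sets quenched_walk_sets(1)[OF walk] in auto)
  also have "\<dots> = prob ?D + prob ?U"
    using sets by (intro finite_measure_Union) auto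
  finally show ?thesis
    unfolding D U by (simp only: of_nat_Suc add.commute[of "int n" 1])
qed

theorem lemma1:
  fixes M :: "'a measure"
    and N :: "int \<Rightarrow> 'a \<Rightarrow> nat"
    and S :: "int \<Rightarrow> nat \<Rightarrow> int \<Rightarrow> 'a \<Rightarrow> int"
    and \<omega> :: env
    and P :: "'b measure"
    and X :: "nat \<Rightarrow> 'b \<Rightarrow> int \<times> int"
    and t :: nat and y :: int
  assumes "poisson_walk_system M N S"
    and "\<omega> \<in> environment N S ` space M"
    and "occ \<omega> 0 0 > 0"
    and "quenched_walk \<omega> P X"
  shows "mass \<omega> t y = \<P>(w in P. X t w = (int t, y))"
proof (induction t arbitrary: y)
  case 0
  interpret prob_space P
    using assms(4) by (rule quenched_walk_prob_space)
  have origin: "\<P>(w in P. X 0 w = (0, 0)) = 1"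
    using assms(4) by (simp add: quenched_walk_def)
  then have "AE w in P. X 0 w = (0, 0)"
    using quenched_walk_sets(1)[OF assms(4)] by (simp add: prob_Collect_eq_1)
  then have "AE w in P. X 0 w \<noteq> (0, y)" if "y \<noteq> 0"
    by eventually_elim (use that in auto)
  then have "\<P>(w in P. X 0 w = (0, y)) = 0" if "y \<noteq> 0"
    using that by (intro prob_eq_0_AE) auto
  with origin show ?case
    by simp
next
  case (Suc t)
  have inflow: "occ \<omega> s x = eplus \<omega> (s - 1) (x - 1) + eminus \<omega> (s - 1) (x + 1)" for s x
    using assms(2) occ_inflow[OF assms(1)] by auto
  show ?case
    unfolding quenched_walk_prob_Suc[OF inflow assms(3,4)] mass.simps Suc.IH ..
qed

end
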